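(* Let $T=1$ and $N\in\mathbb{N}$ (with $N\ge 1$). Let $\tilde\mu$ be a real number with $\tilde\mu<-\cot^2\frac{\pi}{2(N+1)}$. Then there is no choice of real numbers $a_1,\ldots,a_N$ satisfying $a_1+\cdots+a_N=1$ such that, for every $\mu\in(\tilde\mu,1)$, all of the roots of the polynomial $p(\lambda)=\lambda^{(N-1)T+1}-\mu\,(q(\lambda))^T$, where $q(\lambda)=a_1\lambda^{N-1}+\cdots+a_{N-1}\lambda+a_N$, lie in the unit disc $\{z\in\mathbb{C}:|z|<1\}$.
   Context: For $T,N\in\mathbb{N}$, real $a_1,\ldots,a_N$ with $a_1+\cdots+a_N=1$, and real $\mu$, define $q(\lambda)=a_1\lambda^{N-1}+\cdots+a_{N-1}\lambda+a_N$ and $p(\lambda)=\lambda^{(N-1)T+1}-\mu\,(q(\lambda))^T$. Here $T=1$, so $p(\lambda)=\lambda^{N}-\mu\,q(\lambda)$. *)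

theory Defs
  imports Complex_Main "HOL-Computational_Algebra.Polynomial"
begin

text \<open>The coefficients are a function on \<^typ>\<open>nat\<close>, of which only the values
  \<open>a 1, \<dots>, a N\<close> are used.\<close>

definition q_poly :: "nat \<Rightarrow> (nat \<Rightarrow> real) \<Rightarrow> real poly" where
  "q_poly N a = (\<Sum>j=1..N. monom (a j) (N - j))"

text \<open>For \<open>N \<ge> 1\<close> the subtraction in the exponent does not truncate.\<close>

definition p_poly :: "nat \<Rightarrow> nat \<Rightarrow> (nat \<Rightarrow> real) \<Rightarrow> real \<Rightarrow> real poly" where
  "p_poly T N a \<mu> = monom 1 ((N - 1) * T + 1) - smult \<mu> (q_poly N a ^ T)"

end

theory Submission
  imports Defs "HOL-Analysis.Complex_Transcendental"
begin

text \<open>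
  Put \<open>F(\<zeta>) = a\<^sub>1 \<zeta> + \<dots> + a\<^sub>N \<zeta>\<^sup>N\<close>, so that \<open>F(1) = 1\<close> and \<open>p(\<lambda>) = \<lambda>\<^sup>N (1 - \<mu> F(1/\<lambda>))\<close>.
  If the roots of \<open>p\<close> stay in the open disc for all \<open>\<mu>\<close> in question, then \<open>1 - \<mu> F(\<zeta>)\<close> does not
  vanish for \<open>|\<zeta>| = 1\<close>. Letting \<open>\<mu>\<close> run from a negative value to \<open>0\<close>, where the expression is \<open>1\<close>,
  one sees that \<open>1 - \<mu> F(\<zeta>)\<close> never meets the half-line of nonpositive reals, and so its principal
  argument is continuous, even when \<open>\<mu>\<close> varies together with \<open>\<zeta>\<close>.

  Let \<open>\<phi> = \<pi>/(N+1)\<close> and let \<open>\<mu>(t) = (cos t - cos \<phi>)/(1 - cos \<phi>)\<close>. This is the affine function of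
  \<open>cos t\<close> with value \<open>1\<close> at \<open>t = 0\<close> and \<open>0\<close> at \<open>t = \<phi>\<close>; on \<open>[\<phi>, 2\<pi> - \<phi>]\<close> it takes values in
  \<open>[-cot\<^sup>2(\<phi>/2), 0]\<close>, the minimum at \<open>t = \<pi>\<close>, which is where the bound of the theorem comes from.
  Write \<open>cis t\<close> for the point of the unit circle with angle \<open>t\<close> and consider
  \<open>v(t) = Re (cis (-(N+1)t/2) (1 - \<mu>(t) F(cis t)))\<close>.
  At both ends of \<open>[\<phi>, 2\<pi> - \<phi>]\<close> the bracket is \<open>1\<close>, so the argument of the rotated
  curve moves continuously from \<open>-\<pi>/2\<close> to \<open>-\<pi>/2 - N\<pi>\<close>, and \<open>v\<close> has at least \<open>N + 1\<close> zeros there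
  (\<open>rotated_curve_attains_angle\<close>). Another zero is \<open>t = 0\<close>, since \<open>\<mu>(0) = F(1) = 1\<close>. But up to a nonvanishing
  factor \<open>v(t)\<close> is the value at \<open>cis t\<close> of a polynomial of degree at most \<open>N + 1\<close>
  (\<open>poly_sym_poly_cis\<close>, \<open>degree_sym_poly_le\<close>), so \<open>v\<close> vanishes identically. That is impossible, because
  the argument also passes through \<open>-\<pi>\<close>.
\<close>

section \<open>Values of the polynomial on the unit circle\<close>

text \<open>This is the function \<open>F\<close> above, related to \<open>q\<close> by \<open>F(w) = w\<^sup>N q(1/w)\<close>.\<close>

definition rev_q :: "nat \<Rightarrow> (nat \<Rightarrow> real) \<Rightarrow> complex \<Rightarrow> complex" where
  "rev_q N a w = (\<Sum>j=1..N. of_real (a j) * w ^ j)"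

lemma poly_p_poly_inverse:
  assumes N: "N \<ge> 1" and "w \<noteq> 0"
  shows "poly (map_poly complex_of_real (p_poly 1 N a \<mu>)) (inverse w)
           = inverse w ^ N * (1 - of_real \<mu> * rev_q N a w)"
proof -
  have "map_poly complex_of_real (p_poly 1 N a \<mu>) =
      monom 1 (N - 1 + 1) - smult (of_real \<mu>) (\<Sum>j=1..N. monom (of_real (a j)) (N - j))"
    by (cases "N = 0") (auto intro!: poly_eqI sum.cong
        simp: p_poly_def q_poly_def coeff_map_poly coeff_sum if_distrib)
  then have "poly (map_poly complex_of_real (p_poly 1 N a \<mu>)) (inverse w) =
      inverse w ^ N - of_real \<mu> * (\<Sum>j=1..N. of_real (a j) * inverse w ^ (N - j))"
    using N by (simp only:) (simp add: poly_sum poly_monom)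
  also have "(\<Sum>j=1..N. of_real (a j) * inverse w ^ (N - j)) = inverse w ^ N * rev_q N a w"
    unfolding rev_q_def sum_distrib_left
  proof (intro sum.cong refl)
    fix j assume "j \<in> {1..N}"
    then show "of_real (a j) * inverse w ^ (N - j) = inverse w ^ N * (of_real (a j) * w ^ j)"
      using assms by (simp add: power_diff field_simps)
  qed
  finally show ?thesis by (simp add: algebra_simps)
qed

text \<open>The segment from \<open>1\<close> to \<open>1 - m w\<close> consists of the points \<open>1 - \<mu> w\<close>. If it avoids \<open>0\<close>, its
  endpoint is not on the half-line opposite to \<open>1\<close>.\<close>

lemma segment_endpoint_notin_nonpos_Reals:
  fixes m :: real and w :: complex
  assumes "m \<le> 0" and "\<And>\<mu>. m \<le> \<mu> \<Longrightarrow> \<mu> \<le> 0 \<Longrightarrow> 1 - of_real \<mu> * w \<noteq> 0"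
  shows "1 - of_real m * w \<notin> \<real>\<^sub>\<le>\<^sub>0"
proof
  assume "1 - of_real m * w \<in> \<real>\<^sub>\<le>\<^sub>0"
  then obtain r where r: "r \<le> 0" "1 - of_real m * w = of_real r"
    by (elim nonpos_Reals_cases) auto
  have "of_real m * w = of_real (1 - r)"
    using r(2) by (simp add: algebra_simps)
  then have "1 - of_real (m / (1 - r)) * w = 0"
    using r(1) by (simp add: field_simps)
  moreover have "m \<le> m / (1 - r)" "m / (1 - r) \<le> 0"
    using assms(1) r(1) by (auto simp: field_simps mult_nonpos_nonpos)
  ultimately show False using assms(2) by blast
qed

section \<open>The argument along the rotated curve\<close>

text \<open>A curve off the half-line of nonpositive reals that starts and ends at \<open>1\<close> does not contribute
  to the total change of the argument, which is then that of the rotation alone.\<close>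

lemma rotated_curve_attains_angle:
  fixes Y :: "real \<Rightarrow> complex" and c :: real
  assumes "s \<le> e" and "continuous_on {s..e} Y" and "\<And>t. t \<in> {s..e} \<Longrightarrow> Y t \<notin> \<real>\<^sub>\<le>\<^sub>0"
    and "Y s = 1" "Y e = 1" and "- c * e \<le> y" "y \<le> - c * s"
  obtains t where "t \<in> {s..e}" "Y t \<noteq> 0" "Im (Ln (Y t)) - c * t = y"
    "cis (- c * t) * Y t = of_real (norm (Y t)) * cis y"
proof -
  have "continuous_on {s..e} (\<lambda>t. Im (Ln (Y t)) - c * t)"
    using assms(2,3) by (intro continuous_intros) auto
  then obtain t where t: "t \<in> {s..e}" "Im (Ln (Y t)) - c * t = y"
    using IVT2'[of "\<lambda>t. Im (Ln (Y t)) - c * t" e y s] assms by auto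
  have nz: "Y t \<noteq> 0" using assms(3)[OF t(1)] by auto
  have "Y t = exp (Ln (Y t))" using nz by simp
  also have "\<dots> = of_real (norm (Y t)) * cis (Im (Ln (Y t)))"
    using nz by (simp add: exp_eq_polar Re_Ln flip: exp_of_real)
  finally have "cis (- c * t) * Y t = of_real (norm (Y t)) * (cis (- c * t) * cis (Im (Ln (Y t))))"
    by (metis mult.left_commute)
  also have "cis (- c * t) * cis (Im (Ln (Y t))) = cis y"
    using t(2) by (simp add: cis_mult algebra_simps)
  finally show thesis using that t nz by blast
qed

section \<open>The symmetrised polynomial\<close>

text \<open>Let \<open>\<zeta> = cis t\<close> and \<open>Y = 1 - \<mu> F(\<zeta>)\<close> with \<open>\<mu> = (cos t - b)/(1 - b)\<close>. The following polynomial
  expresses \<open>Y + \<zeta>\<^sup>N \<zeta> cnj Y\<close> in terms of \<open>\<zeta>\<close>, by means of \<open>cnj \<zeta> = 1/\<zeta>\<close>. As \<open>F\<close> has no constant term, the factor \<open>1/\<zeta>\<close> in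
  \<open>2 cos t = \<zeta> + 1/\<zeta>\<close> cancels, and the degree does not exceed \<open>N + 1\<close>.\<close>

definition sym_poly :: "nat \<Rightarrow> (nat \<Rightarrow> real) \<Rightarrow> real \<Rightarrow> complex poly" where
  "sym_poly N a b = 1 + monom 1 (N + 1) -
     smult (of_real (1 / (2 * (1 - b))))
       ([:1, - 2 * of_real b, 1:] *
        (\<Sum>j=1..N. monom (of_real (a j)) (j - 1) + monom (of_real (a j)) (N - j)))"

lemma degree_sym_poly_le:
  assumes "N \<ge> 1"
  shows "degree (sym_poly N a b) \<le> N + 1"
proof -
  let ?S = "\<Sum>j=1..N. monom (complex_of_real (a j)) (j - 1) + monom (of_real (a j)) (N - j)"
  have "degree (monom (complex_of_real (a j)) (j - 1) + monom (of_real (a j)) (N - j)) \<le> N - 1"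
    if "j \<in> {1..N}" for j
    using that by (intro degree_add_le) (auto intro: order_trans[OF degree_monom_le])
  then have "degree ?S \<le> N - 1" by (intro degree_sum_le) auto
  then have "degree ([:1, - 2 * of_real b, 1:] * ?S) \<le> 2 + (N - 1)"
    by (intro order_trans[OF degree_mult_le] add_mono) auto
  then show ?thesis
    unfolding sym_poly_def using assms
    by (intro degree_diff_le degree_add_le order_trans[OF degree_smult_le] degree_monom_le) auto
qed

lemma poly_sym_poly_one:
  assumes "(\<Sum>j=1..N. a j) = 1" and "b \<noteq> 1"
  shows "poly (sym_poly N a b) 1 = 0"
proof -
  have "(\<Sum>j=1..N. complex_of_real (a j) + of_real (a j)) = 2"
    using arg_cong[OF assms(1), of "\<lambda>x. 2 * complex_of_real x"] by (simp add: sum_distrib_left)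
  then show ?thesis
    using assms(2) by (simp add: sym_poly_def poly_sum poly_monom field_simps)
qed

text \<open>The coefficients \<open>a\<^sub>j\<close> being real, \<open>cnj Y\<close> is obtained by replacing \<open>\<zeta>\<close> with \<open>1/\<zeta>\<close>. Taking
  half of the power \<open>\<zeta>\<^sup>N \<zeta>\<close> out of \<open>Y + \<zeta>\<^sup>N \<zeta> cnj Y\<close> leaves a number plus its conjugate.\<close>

lemma poly_sym_poly_cis:
  fixes N :: nat and a :: "nat \<Rightarrow> real" and b t :: real
  defines "Y \<equiv> 1 - of_real ((cos t - b) / (1 - b)) * rev_q N a (cis t)"
  shows "poly (sym_poly N a b) (cis t) =
           2 * cis ((real N + 1) / 2 * t) * of_real (Re (cis (- ((real N + 1) / 2) * t) * Y))"
proof -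
  define z where "z = cis t"
  define c where "c = (real N + 1) / 2"
  define d :: complex where "d = of_real (cos t - b)"
  have z: "z \<noteq> 0" "cnj z = inverse z" by (auto simp: z_def cis_cnj)
  have "of_real (2 * cos t) = z + inverse z"
    by (simp add: z_def complex_eq_iff)
  then have quad: "poly [:1, - 2 * of_real b, 1:] z = 2 * d * z"
    using z(1) by (simp add: d_def field_simps power2_eq_square)
  have term_eq: "(2 * d * z) * (z ^ (j - 1) + z ^ (N - j)) = 2 * d * (z ^ j + z ^ (N + 1) * inverse z ^ j)"
    if "j \<in> {1..N}" for j
  proof -
    have "z * z ^ (j - 1) = z ^ j"
      using that by (cases j) auto
    moreover have "z * z ^ (N - j) = z ^ (N + 1) * inverse z ^ j"
      using that z(1) by (simp add: power_diff field_simps)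
    ultimately show ?thesis by (metis distrib_left mult.assoc)
  qed
  have "poly ([:1, - 2 * of_real b, 1:] *
        (\<Sum>j=1..N. monom (of_real (a j)) (j - 1) + monom (of_real (a j)) (N - j))) z =
      (\<Sum>j=1..N. of_real (a j) * (2 * d * (z ^ j + z ^ (N + 1) * inverse z ^ j)))"
    unfolding poly_mult quad poly_sum sum_distrib_left
  proof (intro sum.cong refl)
    fix j assume j: "j \<in> {1..N}"
    show "2 * d * z * poly (monom (of_real (a j)) (j - 1) + monom (of_real (a j)) (N - j)) z =
        of_real (a j) * (2 * d * (z ^ j + z ^ (N + 1) * inverse z ^ j))"
      unfolding term_eq[OF j, symmetric] poly_add poly_monom by (simp only: algebra_simps)
  qed
  also have "\<dots> = 2 * d * (rev_q N a z + z ^ (N + 1) * cnj (rev_q N a z))"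
    by (simp add: rev_q_def z(2) sum_distrib_left sum.distrib algebra_simps)
  finally have "poly (sym_poly N a b) z = 1 + z ^ (N + 1) -
      of_real (1 / (2 * (1 - b))) * (2 * d * (rev_q N a z + z ^ (N + 1) * cnj (rev_q N a z)))"
    unfolding sym_poly_def by (simp add: poly_monom)
  also have "\<dots> = Y + z ^ (N + 1) * cnj Y"
  proof -
    define e :: complex where "e = of_real ((cos t - b) / (1 - b))"
    have e: "of_real (1 / (2 * (1 - b))) * (2 * d * x) = e * x" for x :: complex
    proof -
      have "(cos t - b) / (1 - b) = 1 / (2 * (1 - b)) * (2 * (cos t - b))"
        using mult_divide_mult_cancel_left[of 2 "cos t - b" "1 - b"]
        by (simp only: times_divide_eq_left mult_1_left)
      then show ?thesis by (simp only: e_def d_def of_real_mult of_real_numeral mult.assoc)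
    qed
    have Y: "Y = 1 - e * rev_q N a z" by (simp add: Y_def e_def z_def)
    have "cnj e = e" by (simp add: e_def)
    then show ?thesis unfolding e Y by (simp add: algebra_simps)
  qed
  also have "z ^ (N + 1) = cis (c * t) * cis (c * t)"
  proof -
    have "c * t + c * t = real (N + 1) * t" by (simp add: c_def field_simps)
    then show ?thesis by (simp only: z_def Complex.DeMoivre cis_mult)
  qed
  also have "Y + cis (c * t) * cis (c * t) * cnj Y = cis (c * t) * (cis (- c * t) * Y + cnj (cis (- c * t) * Y))"
    by (simp add: cis_cnj algebra_simps flip: cis_inverse)
  also have "\<dots> = cis (c * t) * of_real (2 * Re (cis (- c * t) * Y))"
    by (simp only: complex_add_cnj)
  finally show ?thesis by (simp add: z_def c_def)
qed

section \<open>The bound for the parameter\<close>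

lemma neg_cot_half_squared:
  fixes x :: real
  assumes "sin (x / 2) \<noteq> 0"
  shows "(- 1 - cos x) / (1 - cos x) = - (cot (x / 2))\<^sup>2"
proof -
  have c: "cos x = 2 * (cos (x / 2))\<^sup>2 - 1" using cos_double_cos[of "x / 2"] by simp
  have s: "cos x = 1 - 2 * (sin (x / 2))\<^sup>2" using cos_double_sin[of "x / 2"] by simp
  have "(- 1 - cos x) / (1 - cos x) = (- 2 * (cos (x / 2))\<^sup>2) / (2 * (sin (x / 2))\<^sup>2)"
    by (subst c, subst s) simp
  then show ?thesis by (simp add: cot_def power_divide)
qed

text \<open>This is the core of the argument: without such a \<open>\<mu>\<close> and \<open>w\<close>, the symmetrised polynomial would
  have more roots on the unit circle than its degree permits. The cotangent enters as the value at
  \<open>t = \<pi>\<close> of the parameter \<open>\<mu>(t)\<close>, its minimum.\<close>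

lemma exists_unit_circle_zero:
  fixes N :: nat and a :: "nat \<Rightarrow> real" and m :: real
  assumes N: "N \<ge> 1" and sum: "(\<Sum>j=1..N. a j) = 1"
    and m: "m = - (cot (pi / (2 * (real N + 1))))\<^sup>2"
  shows "\<exists>\<mu> w. m \<le> \<mu> \<and> \<mu> \<le> 0 \<and> norm w = 1 \<and> 1 - of_real \<mu> * rev_q N a w = 0"
proof (rule ccontr)
  assume "\<not> ?thesis"
  then have nz: "1 - of_real \<mu> * rev_q N a w \<noteq> 0" if "m \<le> \<mu>" "\<mu> \<le> 0" "norm w = 1" for \<mu> w
    using that by blast
  \<comment> \<open>For this \<open>\<phi>\<close> the rotation by \<open>-(N+1)t/2\<close> has angle \<open>-\<pi>/2\<close> at \<open>t = \<phi>\<close>.\<close>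
  define \<phi> where "\<phi> = pi / (real N + 1)"
  define b where "b = cos \<phi>"
  define par where "par t = (cos t - b) / (1 - b)" for t
  define Y where "Y t = 1 - of_real (par t) * rev_q N a (cis t)" for t
  define c where "c = (real N + 1) / 2"
  have \<phi>: "0 < \<phi>" "\<phi> \<le> pi / 2"
  proof -
    show "0 < \<phi>" by (simp add: \<phi>_def)
    show "\<phi> \<le> pi / 2" unfolding \<phi>_def using N by (intro divide_left_mono) auto
  qed
  have c\<phi>: "c * \<phi> = pi / 2" by (simp add: c_def \<phi>_def divide_simps)
  have b1: "b < 1" using cos_monotone_0_pi[of 0 \<phi>] \<phi> by (simp add: b_def)
  have m_eq: "(- 1 - b) / (1 - b) = m"
  proof -
    have "sin (\<phi> / 2) > 0" using \<phi> by (intro sin_gt_zero) auto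
    then have "(- 1 - b) / (1 - b) = - (cot (\<phi> / 2))\<^sup>2"
      unfolding b_def by (intro neg_cot_half_squared) simp
    also have "\<phi> / 2 = pi / (2 * (real N + 1))" by (simp add: \<phi>_def)
    finally show ?thesis using m by simp
  qed
  have par_lower: "m \<le> par t" for t
    unfolding m_eq[symmetric] par_def using b1 by (intro divide_right_mono) auto
  have par_upper: "par t \<le> 0" if "t \<in> {\<phi>..2 * pi - \<phi>}" for t
  proof -
    have "cos t \<le> cos \<phi>"
    proof (cases "t \<le> pi")
      case True
      then show ?thesis using that \<phi> by (intro cos_monotone_0_pi_le) auto
    next
      case False
      then have "cos (2 * pi - t) \<le> cos \<phi>" using that \<phi> by (intro cos_monotone_0_pi_le) auto
      then show ?thesis by simp
    qed
    then show ?thesis using b1 by (simp add: par_def b_def divide_nonpos_pos)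
  qed
  have Y_slit: "Y t \<notin> \<real>\<^sub>\<le>\<^sub>0" if "t \<in> {\<phi>..2 * pi - \<phi>}" for t
    unfolding Y_def
  proof (intro segment_endpoint_notin_nonpos_Reals par_upper that)
    fix \<mu> assume "par t \<le> \<mu>" "\<mu> \<le> 0"
    then show "1 - of_real \<mu> * rev_q N a (cis t) \<noteq> 0"
      using nz order_trans[OF par_lower] by simp
  qed
  have Y_cont: "continuous_on {\<phi>..2 * pi - \<phi>} Y"
    unfolding Y_def par_def rev_q_def using b1 by (intro continuous_intros) auto
  have Y_ends: "Y \<phi> = 1" "Y (2 * pi - \<phi>) = 1"
    by (auto simp: Y_def par_def b_def)
  have end_angle: "- c * (2 * pi - \<phi>) = - pi / 2 - real N * pi"
    using c\<phi> by (simp add: c_def algebra_simps)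
  have angle: "\<exists>t\<in>{\<phi>..2 * pi - \<phi>}. Y t \<noteq> 0 \<and> Im (Ln (Y t)) - c * t = y \<and>
      cis (- c * t) * Y t = of_real (norm (Y t)) * cis y"
    if "- pi / 2 - real N * pi \<le> y" "y \<le> - pi / 2" for y
  proof -
    have "\<phi> \<le> 2 * pi - \<phi>" "- c * (2 * pi - \<phi>) \<le> y" "y \<le> - c * \<phi>"
      using \<phi> that end_angle c\<phi> by auto
    then show ?thesis
      using rotated_curve_attains_angle[OF _ Y_cont Y_slit Y_ends] by metis
  qed
  have poly_eq: "poly (sym_poly N a b) (cis t) = 2 * cis (c * t) * of_real (Re (cis (- c * t) * Y t))"
    for t using poly_sym_poly_cis[of N a b t] by (simp add: Y_def par_def c_def)
  \<comment> \<open>Both end angles are themselves odd multiples of \<open>\<pi>/2\<close>, which gives \<open>N + 1\<close> zeros and not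
    just the \<open>N - 1\<close> in the interior.\<close>
  define y where "y k = - pi / 2 - real k * pi" for k :: nat
  have "\<exists>t\<in>{\<phi>..2 * pi - \<phi>}. Im (Ln (Y t)) - c * t = y k \<and> poly (sym_poly N a b) (cis t) = 0"
    if "k \<le> N" for k
  proof -
    have "cos (y k) = 0" by (simp add: y_def cos_diff)
    moreover have "- pi / 2 - real N * pi \<le> y k" "y k \<le> - pi / 2"
      using that by (auto simp: y_def)
    ultimately obtain s where s: "s \<in> {\<phi>..2 * pi - \<phi>}" "Im (Ln (Y s)) - c * s = y k"
      "cis (- c * s) * Y s = of_real (norm (Y s)) * cis (y k)"
      using angle by blast
    then have "poly (sym_poly N a b) (cis s) = 0"
      unfolding poly_eq s(3) using \<open>cos (y k) = 0\<close> by simp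
    then show ?thesis using s by blast
  qed
  then obtain t where t: "\<And>k. k \<le> N \<Longrightarrow> t k \<in> {\<phi>..2 * pi - \<phi>}"
      "\<And>k. k \<le> N \<Longrightarrow> Im (Ln (Y (t k))) - c * t k = y k"
      "\<And>k. k \<le> N \<Longrightarrow> poly (sym_poly N a b) (cis (t k)) = 0"
    by metis
  have cis_inj: "u = v" if "cis u = cis v" "u \<in> {0..<2 * pi}" "v \<in> {0..<2 * pi}" for u v :: real
    using that by (metis atLeastLessThan_iff Arg2pi_unique mult_1 of_real_1 zero_less_one cis_conv_exp)
  have t_range: "t k \<in> {0..<2 * pi}" "t k \<noteq> 0" if "k \<le> N" for k
    using t(1)[OF that] \<phi> by auto
  have "inj_on (\<lambda>k. cis (t k)) {..N}"
  proof (rule inj_onI)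
    fix j k assume jk: "j \<in> {..N}" "k \<in> {..N}" "cis (t j) = cis (t k)"
    then have "t j = t k" using cis_inj t_range by auto
    then have "y j = y k" using t(2) jk by (metis atMost_iff)
    then show "j = k" by (simp add: y_def)
  qed
  then have "card ((\<lambda>k. cis (t k)) ` {..N}) = N + 1" by (simp add: card_image)
  moreover have "1 \<notin> (\<lambda>k. cis (t k)) ` {..N}"
  proof
    assume "1 \<in> (\<lambda>k. cis (t k)) ` {..N}"
    then obtain k where k: "k \<le> N" "cis (t k) = cis 0" by auto
    then show False using cis_inj[of "t k" 0] t_range by auto
  qed
  ultimately have card: "card (insert 1 ((\<lambda>k. cis (t k)) ` {..N})) = N + 2" by simp
  have roots: "insert 1 ((\<lambda>k. cis (t k)) ` {..N}) \<subseteq> {z. poly (sym_poly N a b) z = 0}"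
    using t(3) poly_sym_poly_one[OF sum] b1 by auto
  have "sym_poly N a b = 0"
  proof (rule ccontr)
    assume P: "sym_poly N a b \<noteq> 0"
    have "N + 2 \<le> card {z. poly (sym_poly N a b) z = 0}"
      using card_mono[OF poly_roots_finite[OF P] roots] card by simp
    also have "\<dots> \<le> N + 1"
      using card_poly_roots_bound[OF P] degree_sym_poly_le[OF N, of a b] by simp
    finally show False by simp
  qed
  \<comment> \<open>At the angle \<open>-\<pi>\<close> the rotated curve is on the negative real axis, so its real part is not \<open>0\<close>.\<close>
  moreover obtain s where "Y s \<noteq> 0" "cis (- c * s) * Y s = of_real (norm (Y s)) * cis (- pi)"
  proof -
    have "1 * pi \<le> real N * pi" using N by (intro mult_right_mono) auto
    then have "- pi / 2 - real N * pi \<le> - pi"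
      using pi_gt_zero by linarith
    then show thesis using angle[of "- pi"] that pi_gt_zero by auto
  qed
  ultimately show False using poly_eq[of s] by simp
qed

theorem theorem2:
  fixes T N :: nat and \<mu>' :: real
  assumes "T = 1" and "N \<ge> 1"
    and "\<mu>' < - (cot (pi / (2 * (real N + 1))))\<^sup>2"
  shows "\<not> (\<exists>a :: nat \<Rightarrow> real. (\<Sum>j=1..N. a j) = 1 \<and>
           (\<forall>\<mu>\<in>{\<mu>'<..<1}. \<forall>z :: complex.
              poly (map_poly complex_of_real (p_poly T N a \<mu>)) z = 0 \<longrightarrow> norm z < 1))"
proof
  assume "\<exists>a :: nat \<Rightarrow> real. (\<Sum>j=1..N. a j) = 1 \<and>
           (\<forall>\<mu>\<in>{\<mu>'<..<1}. \<forall>z :: complex.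
              poly (map_poly complex_of_real (p_poly T N a \<mu>)) z = 0 \<longrightarrow> norm z < 1)"
  then obtain a :: "nat \<Rightarrow> real" where sum: "(\<Sum>j=1..N. a j) = 1"
    and stable: "\<And>\<mu> z. \<mu> \<in> {\<mu>'<..<1} \<Longrightarrow>
      poly (map_poly complex_of_real (p_poly T N a \<mu>)) z = 0 \<Longrightarrow> norm z < 1"
    by blast
  obtain \<mu> w where *: "- (cot (pi / (2 * (real N + 1))))\<^sup>2 \<le> \<mu>" "\<mu> \<le> 0"
    "norm w = 1" "1 - of_real \<mu> * rev_q N a w = 0"
    using exists_unit_circle_zero[OF assms(2) sum refl] by blast
  have "w \<noteq> 0" using *(3) by auto
  then have "poly (map_poly complex_of_real (p_poly T N a \<mu>)) (inverse w) = 0"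
    using poly_p_poly_inverse[OF assms(2), of w a \<mu>] *(4) assms(1) by simp
  then have "norm (inverse w) < 1"
    using *(1,2) assms(3) by (intro stable[of \<mu>]) auto
  then show False using *(3) by (simp add: norm_inverse)
qed

end
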